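(* Let $k\ge 4$ be an even integer and let $G$ be a connected graph of order $n$, size $m$ and maximum degree $\Delta(G)\le k$. Then $$\alpha'(G) \ge \frac{n}{k(k+1)} + \frac{m}{k+1} - \frac{1}{k(k+1)},$$ unless one of the following holds: (a) $G$ is $k$-regular and $n=k+1$, in which case $\alpha'(G) = \frac{n-1}{2} = \frac{n}{k(k+1)} + \frac{m}{k+1} - \frac{1}{k}$; (b) $G$ is $k$-regular and $n=k+3$, in which case $\alpha'(G) = \frac{n-1}{2} = \frac{n}{k(k+1)} + \frac{m}{k+1} - \frac{3}{k(k+1)}$.
   Context: Graphs are finite, simple and undirected, with at least one vertex. The order of a graph is its number of vertices and the size is its number of edges. The matching number $\alpha'(G)$ is the maximum number of edges in a matching of $G$. *)

theory Defs
  imports Complex_Main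
begin

locale simple_graph =
  fixes V :: "'a set" and E :: "'a set set"
  assumes finite_V: "finite V"
    and V_nonempty: "V \<noteq> {}"
    and edge_subset: "e \<in> E \<Longrightarrow> e \<subseteq> V"
    and edge_card: "e \<in> E \<Longrightarrow> card e = 2"

definition degree :: "'a set set \<Rightarrow> 'a \<Rightarrow> nat" where
  "degree E v = card {e \<in> E. v \<in> e}"

definition max_degree :: "'a set \<Rightarrow> 'a set set \<Rightarrow> nat" where
  "max_degree V E = Max (degree E ` V)"

definition regular :: "nat \<Rightarrow> 'a set \<Rightarrow> 'a set set \<Rightarrow> bool" where
  "regular k V E \<longleftrightarrow> (\<forall>v\<in>V. degree E v = k)"

definition connected_graph :: "'a set \<Rightarrow> 'a set set \<Rightarrow> bool" where
  "connected_graph V E \<longleftrightarrow> (\<forall>u\<in>V. \<forall>v\<in>V. (u, v) \<in> {(x, y). {x, y} \<in> E}\<^sup>*)"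

definition matching :: "'a set set \<Rightarrow> 'a set set \<Rightarrow> bool" where
  "matching E M \<longleftrightarrow> M \<subseteq> E \<and> pairwise disjnt M"

definition matching_number :: "'a set set \<Rightarrow> nat" where
  "matching_number E = Max (card ` {M. matching E M})"

end

theory Submission
  imports Defs
begin

text \<open>
  By the Tutte-Berge formula there are a set \<open>S\<close> and disjoint odd sets \<open>C\<close>, \<open>q\<close> in number, each joined
  only to \<open>S\<close>, with \<open>2 \<alpha>' \<ge> n + |S| - q\<close>; it is obtained from Gallai's lemma, by deleting vertices that
  every maximum matching covers. If \<open>S\<close> is non-empty, connectivity makes the number \<open>t\<close> of edges
  meeting \<open>S\<close> at least \<open>|S| + q - 1\<close>, while \<open>t \<le> k |S|\<close>, and each odd set \<open>C\<close> sends an edge to \<open>S\<close>.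
  As \<open>k |C|\<close> is even, \<open>C\<close> then spans at most \<open>k |C| / 2 - 1\<close> edges, so that
  \<open>2 (|C| + k m\<^sub>C - 1) \<le> k (k + 1) (|C| - 1)\<close>; summing up gives the bound. If \<open>S\<close> is empty, then
  \<open>q \<le> 1\<close>, and the bound fails only for regular graphs of order \<open>k + 1\<close> or \<open>k + 3\<close>.
\<close>

subsection \<open>Maximum matchings\<close>

definition maximum_matching :: "'a set set \<Rightarrow> 'a set set \<Rightarrow> bool" where
  "maximum_matching E M \<longleftrightarrow> matching E M \<and> card M = matching_number E"

lemma finite_matchings: "finite E \<Longrightarrow> finite {M. matching E M}"
  by (rule finite_subset[of _ "Pow E"]) (auto simp: matching_def)

lemma matching_finite: "finite E \<Longrightarrow> matching E M \<Longrightarrow> finite M"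
  by (auto simp: matching_def intro: finite_subset)

lemma card_matching_le: "finite E \<Longrightarrow> matching E M \<Longrightarrow> card M \<le> matching_number E"
  unfolding matching_number_def using finite_matchings by (intro Max_ge) auto

lemma maximum_matching_exists:
  assumes "finite E" obtains M where "maximum_matching E M"
proof -
  have "matching E {}" by (auto simp: matching_def)
  then have "matching_number E \<in> card ` {M. matching E M}"
    unfolding matching_number_def using finite_matchings[OF assms] by (intro Max_in) auto
  then show ?thesis using that by (auto simp: maximum_matching_def)
qed

lemma matching_insert:
  assumes "matching E M" and "e \<in> E" and "e \<inter> \<Union>M = {}"
  shows "matching E (insert e M)"
  using assms unfolding matching_def pairwise_insert by (auto simp: disjnt_def)

lemma card_Union_pairs:
  assumes "finite M" and "pairwise disjnt M" and "\<forall>e\<in>M. card e = 2"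
  shows "card (\<Union>M) = 2 * card M"
proof -
  have "finite e" if "e \<in> M" for e
    using assms(3) that by (metis card.infinite zero_neq_numeral)
  then have "card (\<Union>M) = (\<Sum>e\<in>M. card e)"
    using assms(2) by (intro card_Union_disjoint)
  then show ?thesis using assms(3) by simp
qed

lemma two_card_matching:
  assumes "finite E" and "\<forall>e\<in>E. card e = 2" and "matching E M"
  shows "card (\<Union>M) = 2 * card M"
  using assms matching_finite by (intro card_Union_pairs) (auto simp: matching_def)

lemma maximum_matching_meets_edge:
  assumes "finite E" and "maximum_matching E M" and "e \<in> E" and "e \<noteq> {}"
  shows "e \<inter> \<Union>M \<noteq> {}"
proof
  assume disj: "e \<inter> \<Union>M = {}"
  then have "matching E (insert e M)"
    using assms by (intro matching_insert) (auto simp: maximum_matching_def)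
  then have "card (insert e M) \<le> matching_number E"
    using assms(1) card_matching_le by blast
  moreover have "e \<notin> M" using disj assms(4) by auto
  moreover have "finite M" using assms by (auto simp: maximum_matching_def intro: matching_finite)
  ultimately show False using assms(2) by (simp add: maximum_matching_def)
qed

subsection \<open>Gallai's lemma and the Tutte-Berge formula\<close>

text \<open>The disjunct \<open>u = v\<close> makes the relation reflexive. When every vertex is
  missed by some maximum matching, it is also transitive and contains adjacency, so it holds
  throughout each connected component.\<close>

definition not_both_missed :: "'a set set \<Rightarrow> 'a \<Rightarrow> 'a \<Rightarrow> bool" where
  "not_both_missed E u v \<longleftrightarrow>
     u = v \<or> (\<forall>M. maximum_matching E M \<longrightarrow> u \<in> \<Union>M \<or> v \<in> \<Union>M)"

text \<open>
  Suppose \<open>M\<close> misses \<open>u\<close> and \<open>v\<close>. Among the maximum matchings missing \<open>t\<close>, the one closest to \<open>M\<close>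
  can be brought still closer by exchanging one edge.
\<close>

lemma not_both_missed_trans:
  assumes fin: "finite E" and two: "\<forall>e\<in>E. card e = 2"
    and missed: "maximum_matching E N0" "t \<notin> \<Union>N0"
    and ut: "not_both_missed E u t" and tv: "not_both_missed E t v"
  shows "not_both_missed E u v"
proof (rule ccontr)
  assume "\<not> not_both_missed E u v"
  then obtain M where uv: "u \<noteq> v" and M: "maximum_matching E M" and uM: "u \<notin> \<Union>M" and vM: "v \<notin> \<Union>M"
    by (auto simp: not_both_missed_def)
  have tM: "t \<in> \<Union>M"
    using ut tv uv M uM vM unfolding not_both_missed_def by blast
  define P where "P N \<longleftrightarrow> maximum_matching E N \<and> t \<notin> \<Union>N" for N
  \<comment> \<open>Closeness to \<open>M\<close> is the number of shared edges; being bounded, it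
    attains a largest value.\<close>
  have bound: "\<forall>N. P N \<longrightarrow> card (M \<inter> N) < Suc (card E)"
    using fin M by (auto simp: maximum_matching_def matching_def less_Suc_eq_le intro!: card_mono)
  obtain N where N: "P N" and maxN: "\<And>N'. P N' \<Longrightarrow> card (M \<inter> N') \<le> card (M \<inter> N)"
    using ex_has_greatest_nat[of P N0 "\<lambda>N. card (M \<inter> N)", OF _ bound] missed
    by (auto simp: P_def)
  have mM: "matching E M" and mN: "matching E N" and cMN: "card M = card N"
    and maxi: "maximum_matching E N" and tN: "t \<notin> \<Union>N"
    using M N by (auto simp: P_def maximum_matching_def)
  have finM: "finite M" "finite N" using mM mN fin matching_finite by auto
  have cM: "card (\<Union>M) = 2 * card M" and cN: "card (\<Union>N) = 2 * card N"
    using two_card_matching[OF fin two] mM mN by auto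
  have cpos: "card M > 0" using tM finM by (auto simp: card_gt_0_iff)
  have finU: "finite (\<Union>M)" "finite (\<Union>N)"
    using cM cN cpos cMN by (metis card.infinite mult_eq_0_iff neq0_conv zero_neq_numeral)+
  have uN: "u \<in> \<Union>N" "v \<in> \<Union>N"
    using ut tv maxi tN uM vM tM unfolding not_both_missed_def by blast+
  \<comment> \<open>\<open>M\<close> and \<open>N\<close> cover equally many vertices, and
    \<open>N\<close> covers \<open>u\<close> and \<open>v\<close>, which \<open>M\<close> misses. So
    \<open>M\<close> covers at least two vertices that \<open>N\<close> misses, and one of them is
    not \<open>t\<close>.\<close>
  have "\<exists>x. x \<in> \<Union>M \<and> x \<notin> \<Union>N \<and> x \<noteq> t"
  proof (rule ccontr)
    assume "\<not> ?thesis"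
    then have "\<Union>M - {t} \<subseteq> \<Union>N - {u, v}" using uM vM by blast
    then have "card (\<Union>M - {t}) \<le> card (\<Union>N - {u, v})" using finU by (intro card_mono) auto
    moreover have "card (\<Union>M - {t}) = 2 * card M - 1" using tM cM by simp
    moreover have "card (\<Union>N - {u, v}) = 2 * card N - 2"
      using uN uv cN by (subst card_Diff_subset) auto
    ultimately show False using cMN cpos by simp
  qed
  then obtain x where x: "x \<in> \<Union>M" "x \<notin> \<Union>N" "x \<noteq> t" by blast
  then obtain e where e: "e \<in> M" "x \<in> e" by blast
  have eE: "e \<in> E" using e mM by (auto simp: matching_def)
  then obtain y where y: "e = {x, y}"
    using two e(2) by (metis card_2_iff doubleton_eq_iff empty_iff insert_iff)
  have "y \<in> \<Union>N"
    using maximum_matching_meets_edge[OF fin maxi eE] x(2) unfolding y by blast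
  then obtain f where f: "f \<in> N" "y \<in> f" by blast
  \<comment> \<open>The edges \<open>e\<close> and \<open>f\<close> share \<open>y\<close>, and
    \<open>N\<close> misses \<open>x\<close>, so exchanging \<open>f\<close> for \<open>e\<close>
    gives a matching of the same size that still misses \<open>t\<close>. Since \<open>f\<close>
    meets \<open>e\<close> but is not in \<open>M\<close>, one more edge is shared with
    \<open>M\<close>.\<close>
  define N' where "N' = insert e (N - {f})"
  have Nd: "g \<inter> h = {}" if "g \<in> N" "h \<in> N" "g \<noteq> h" for g h
    using mN that by (auto simp: matching_def pairwise_def disjnt_def)
  have Md: "g \<inter> h = {}" if "g \<in> M" "h \<in> M" "g \<noteq> h" for g h
    using mM that by (auto simp: matching_def pairwise_def disjnt_def)
  have "matching E (N - {f})" using mN by (auto simp: matching_def pairwise_def)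
  moreover have "e \<inter> \<Union>(N - {f}) = {}"
    using Nd[OF _ f(1)] f(2) x(2) unfolding y by blast
  ultimately have mN': "matching E N'" unfolding N'_def using eE by (rule_tac matching_insert) auto
  have eN: "e \<notin> N" using e(2) x(2) by blast
  then have "card N' = card N" unfolding N'_def using finM f(1)
    using card_Suc_Diff1[of N f] by simp
  moreover have "t \<notin> \<Union>N'"
    using tN x(3) \<open>y \<in> \<Union>N\<close> unfolding N'_def y by blast
  ultimately have "P N'" using mN' maxi by (auto simp: P_def maximum_matching_def)
  then have "card (M \<inter> N') \<le> card (M \<inter> N)" by (rule maxN)
  moreover have "f \<notin> M"
    using Md[OF _ e(1), of f] f x(2) y by blast
  then have "M \<inter> N' = insert e (M \<inter> N)" unfolding N'_def using e(1) by auto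
  then have "card (M \<inter> N') = Suc (card (M \<inter> N))" using eN finM by simp
  ultimately show False by simp
qed

text \<open>Induction along the path: the ends of an edge are never both missed, as the edge could
  then be added, and \<open>missed\<close> at the intermediate vertex makes transitivity applicable.
  Hence a maximum matching misses at most one vertex of each component.\<close>

lemma Gallai_lemma:
  assumes fin: "finite E" and two: "\<forall>e\<in>E. card e = 2" and sub: "\<forall>e\<in>E. e \<subseteq> V"
    and missed: "\<forall>v\<in>V. \<exists>M. maximum_matching E M \<and> v \<notin> \<Union>M"
    and path: "(u, v) \<in> {(x, y). {x, y} \<in> E}\<^sup>*"
  shows "not_both_missed E u v"
  using path
proof (induction rule: rtrancl_induct)
  case base
  show ?case by (simp add: not_both_missed_def)
next
  case (step y z)
  then have yz: "{y, z} \<in> E" by simp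
  then obtain M where M: "maximum_matching E M" "y \<notin> \<Union>M" using missed sub by blast
  have "not_both_missed E y z"
    using maximum_matching_meets_edge[OF fin _ yz] unfolding not_both_missed_def by blast
  then show ?case using not_both_missed_trans[OF fin two M step.IH] by blast
qed

text \<open>Induction on the number of vertices. If every vertex is missed by some maximum matching,
  \<open>S\<close> is empty and the odd sets are the components containing a vertex missed by one
  fixed maximum matching. Otherwise a vertex that is always covered is deleted and put into
  \<open>S\<close>.\<close>

lemma Tutte_Berge:
  assumes "finite V" and "\<forall>e\<in>E. e \<subseteq> V \<and> card e = 2"
  shows "\<exists>S \<C>. S \<subseteq> V \<and> pairwise disjnt \<C> \<and> (\<forall>C\<in>\<C>. C \<subseteq> V - S \<and> odd (card C)) \<and>
           (\<forall>C\<in>\<C>. \<forall>e\<in>E. e \<inter> C \<noteq> {} \<longrightarrow> e \<subseteq> C \<union> S) \<and>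
           card V + card S \<le> 2 * matching_number E + card \<C>"
  using assms
proof (induction "card V" arbitrary: V E rule: less_induct)
  case less
  note finV = \<open>finite V\<close>
  have two: "\<forall>e\<in>E. card e = 2" and sub: "\<forall>e\<in>E. e \<subseteq> V" using less.prems by auto
  have fin: "finite E" using finV sub by (auto intro: finite_subset[of _ "Pow V"])
  show ?case
  proof (cases "\<forall>v\<in>V. \<exists>M. maximum_matching E M \<and> v \<notin> \<Union>M")
    case True
    obtain M where M: "maximum_matching E M" using maximum_matching_exists[OF fin] .
    then have mM: "matching E M" by (simp add: maximum_matching_def)
    define r where "r = {(x, y). {x, y} \<in> E}"
    define comp where "comp u = {v. (u, v) \<in> r\<^sup>*}" for u
    have "sym r" unfolding r_def sym_def by (auto simp: insert_commute)
    then have sym: "(v, u) \<in> r\<^sup>*" if "(u, v) \<in> r\<^sup>*" for u v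
      using that by (meson sym_rtrancl symD)
    have self: "u \<in> comp u" for u by (simp add: comp_def)
    have comp_eq: "comp u = comp v" if "(u, v) \<in> r\<^sup>*" for u v
      using that sym[OF that] unfolding comp_def by (auto intro: rtrancl_trans)
    have comp_edge: "e \<subseteq> comp u" if e: "e \<in> E" and meet: "e \<inter> comp u \<noteq> {}" for e u
    proof -
      obtain x where x: "x \<in> e" "(u, x) \<in> r\<^sup>*" using meet by (auto simp: comp_def)
      have "(x, y) \<in> r\<^sup>*" if y: "y \<in> e" for y
      proof (cases "x = y")
        case False
        have "e = {x, y}" using two e x(1) y False
          by (metis card_2_iff doubleton_eq_iff empty_iff insert_iff)
        then show ?thesis using e by (auto simp: r_def)
      qed simp
      then show ?thesis using x(2) by (auto simp: comp_def intro: rtrancl_trans)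
    qed
    have comp_sub: "comp u \<subseteq> V" if u: "u \<in> V" for u
    proof
      fix v assume "v \<in> comp u"
      then have "(u, v) \<in> r\<^sup>*" by (simp add: comp_def)
      then show "v \<in> V" by (induction rule: rtrancl_induct) (use u sub in \<open>auto simp: r_def\<close>)
    qed
    \<comment> \<open>By Gallai's lemma a component contains at most one vertex missed by
      \<open>M\<close>. So there is one component in \<open>\<C>\<close> for each missed vertex,
      which makes \<open>card V - 2 * card M\<close> of them.\<close>
    have unique: "u = v" if "(u, v) \<in> r\<^sup>*" "u \<notin> \<Union>M" "v \<notin> \<Union>M" for u v
      using Gallai_lemma[OF fin two sub True, of u v] that M
      unfolding r_def not_both_missed_def by blast
    define \<C> where "\<C> = comp ` (V - \<Union>M)"
    have "inj_on comp (V - \<Union>M)"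
    proof (rule inj_onI)
      fix u v assume uv: "u \<in> V - \<Union>M" "v \<in> V - \<Union>M" "comp u = comp v"
      then have "(u, v) \<in> r\<^sup>*" using self[of v] by (auto simp: comp_def)
      then show "u = v" using unique uv by blast
    qed
    moreover have "\<Union>M \<subseteq> V" using mM sub by (auto simp: matching_def)
    ultimately have "card \<C> = card V - card (\<Union>M)"
      unfolding \<C>_def using finV by (simp add: card_image card_Diff_subset finite_subset)
    then have card: "card V + card ({}::'a set) \<le> 2 * matching_number E + card \<C>"
      using two_card_matching[OF fin two mM] M by (simp add: maximum_matching_def)
    have odd: "odd (card C)" if C: "C \<in> \<C>" for C
    proof -
      obtain u where u: "u \<in> V" "u \<notin> \<Union>M" "C = comp u" using C by (auto simp: \<C>_def)
      define M' where "M' = {e \<in> M. e \<subseteq> comp u}"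
      \<comment> \<open>Every vertex of the component other than \<open>u\<close> is matched, and
        matched inside the component, so the order is one more than twice
        \<open>card M'\<close>.\<close>
      have "C = insert u (\<Union>M')"
      proof
        show "C \<subseteq> insert u (\<Union>M')"
        proof
          fix v assume v: "v \<in> C"
          show "v \<in> insert u (\<Union>M')"
          proof (cases "v = u")
            case False
            then have "v \<in> \<Union>M" using unique[of u v] u v by (auto simp: comp_def)
            then obtain e where e: "e \<in> M" "v \<in> e" by blast
            then have "e \<subseteq> comp u"
              using mM v u(3) by (intro comp_edge) (auto simp: matching_def)
            then show ?thesis using e by (auto simp: M'_def)
          qed simp
        qed
        show "insert u (\<Union>M') \<subseteq> C" using self u(3) by (auto simp: M'_def)
      qed
      moreover have mM': "matching E M'" using mM by (auto simp: matching_def M'_def pairwise_def)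
      moreover have "u \<notin> \<Union>M'" using u(2) by (auto simp: M'_def)
      moreover have "finite (\<Union>M')" using finV comp_sub[OF u(1)]
        by (auto simp: M'_def intro: finite_subset[of _ V])
      ultimately show ?thesis using two_card_matching[OF fin two mM'] by simp
    qed
    have "pairwise disjnt \<C>"
    proof (rule pairwiseI)
      fix C D assume "C \<in> \<C>" "D \<in> \<C>" "C \<noteq> D"
      then obtain u v where uv: "C = comp u" "D = comp v" by (auto simp: \<C>_def)
      have False if "x \<in> comp u" "x \<in> comp v" for x
        using that comp_eq[of u x] comp_eq[of v x] \<open>C \<noteq> D\<close> uv by (simp add: comp_def)
      then show "disjnt C D" using uv by (auto simp: disjnt_def)
    qed
    moreover have "\<forall>C\<in>\<C>. C \<subseteq> V - {} \<and> odd (card C)"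
      using odd comp_sub by (auto simp: \<C>_def)
    moreover have "\<forall>C\<in>\<C>. \<forall>e\<in>E. e \<inter> C \<noteq> {} \<longrightarrow> e \<subseteq> C \<union> {}"
      using comp_edge unfolding \<C>_def by blast
    ultimately show ?thesis using card by (intro exI[of _ "{}"] exI[of _ \<C>]) simp
  next
    case False
    then obtain v where v: "v \<in> V" and cover: "\<And>M. maximum_matching E M \<Longrightarrow> v \<in> \<Union>M" by blast
    define E' where "E' = {e \<in> E. v \<notin> e}"
    have "card (V - {v}) < card V" using v finV by (meson card_Diff1_less)
    moreover have "\<forall>e\<in>E'. e \<subseteq> V - {v} \<and> card e = 2" using less.prems by (auto simp: E'_def)
    ultimately obtain S \<C> where S: "S \<subseteq> V - {v}" and disj: "pairwise disjnt \<C>"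
      and odd: "\<forall>C\<in>\<C>. C \<subseteq> V - {v} - S \<and> odd (card C)"
      and closed: "\<forall>C\<in>\<C>. \<forall>e\<in>E'. e \<inter> C \<noteq> {} \<longrightarrow> e \<subseteq> C \<union> S"
      and card: "card (V - {v}) + card S \<le> 2 * matching_number E' + card \<C>"
      using less.hyps[of "V - {v}" E'] finV by auto
    have "finite E'" using fin by (simp add: E'_def)
    then obtain M where M: "maximum_matching E' M" using maximum_matching_exists by blast
    then have mM: "matching E M" and "v \<notin> \<Union>M"
      by (auto simp: maximum_matching_def matching_def E'_def)
    \<comment> \<open>As a matching of \<open>E\<close> that misses \<open>v\<close>,
      \<open>M\<close> cannot be maximum there: deleting \<open>v\<close> lowers the matching
      number.\<close>
    then have "card M \<noteq> matching_number E" using cover by (auto simp: maximum_matching_def)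
    then have less: "matching_number E' < matching_number E"
      using card_matching_le[OF fin mM] M by (simp add: maximum_matching_def)
    have "card (insert v S) = Suc (card S)" using S finV by (subst card_insert_disjoint) (auto intro: finite_subset)
    moreover have "card V = Suc (card (V - {v}))" using v finV by (metis card_Suc_Diff1)
    \<comment> \<open>Restoring \<open>v\<close> adds two on the left, once in \<open>V\<close> and
      once in \<open>S\<close>, and at least two on the right through the doubled matching
      number.\<close>
    ultimately have card': "card V + card (insert v S) \<le> 2 * matching_number E + card \<C>"
      using card less by linarith
    have closed': "e \<subseteq> C \<union> insert v S" if C: "C \<in> \<C>" and e: "e \<in> E" and meet: "e \<inter> C \<noteq> {}" for C e
    proof (cases "v \<in> e")
      case True
      obtain c where c: "c \<in> e" "c \<in> C" using meet by blast
      then have "c \<noteq> v" using odd C by blast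
      then have "e = {v, c}" using two e c(1) True
        by (metis card_2_iff doubleton_eq_iff empty_iff insert_iff)
      then show ?thesis using c by blast
    next
      case False
      then show ?thesis using closed C e meet by (auto simp: E'_def)
    qed
    have "insert v S \<subseteq> V" using S v by blast
    moreover have "\<forall>C\<in>\<C>. C \<subseteq> V - insert v S \<and> odd (card C)" using odd by blast
    ultimately show ?thesis using disj card' closed'
      by (intro exI[of _ "insert v S"] exI[of _ \<C>]) blast
  qed
qed

subsection \<open>Counting edges\<close>

lemma connected_crossing_edge:
  assumes conn: "connected_graph V E" and sub: "\<forall>e\<in>E. e \<subseteq> V"
    and X: "X \<subseteq> V" "X \<noteq> {}" "X \<noteq> V"
  obtains x y where "{x, y} \<in> E" "x \<in> X" "y \<in> V - X"
proof -
  obtain a b where a: "a \<in> X" and b: "b \<in> V" "b \<notin> X" using X by blast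
  have "(a, b) \<in> {(x, y). {x, y} \<in> E}\<^sup>*"
    using conn a b X(1) by (auto simp: connected_graph_def)
  then have "b \<in> X \<or> (\<exists>x y. {x, y} \<in> E \<and> x \<in> X \<and> y \<in> V - X)"
  proof (induction rule: rtrancl_induct)
    case base
    show ?case using a by simp
  next
    case (step y z)
    then show ?case using sub by blast
  qed
  then show ?thesis using b(2) that by blast
qed

text \<open>Contracting the blocks leaves a connected multigraph, which has at least
  \<open>card \<P> - 1\<close> edges. The blocks are collected one at a time, each along an edge
  leaving the union of those already taken.\<close>

lemma connected_partition_edges:
  assumes conn: "connected_graph V E" and fin: "finite V" and sub: "\<forall>e\<in>E. e \<subseteq> V"
    and part: "\<Union>\<P> = V" "{} \<notin> \<P>" "pairwise disjnt \<P>"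
  shows "card \<P> \<le> card {e\<in>E. \<forall>B\<in>\<P>. \<not> e \<subseteq> B} + 1"
proof -
  have finE: "finite E" using fin sub by (auto intro: finite_subset[of _ "Pow V"])
  have finP: "finite \<P>" using fin part(1) finite_UnionD by auto
  define across where "across \<Q> = {e\<in>E. e \<subseteq> \<Union>\<Q> \<and> (\<forall>B\<in>\<P>. \<not> e \<subseteq> B)}" for \<Q>
  have fin_across: "finite (across \<Q>)" for \<Q> using finE by (simp add: across_def)
  have "\<exists>\<Q>\<subseteq>\<P>. card \<Q> = j \<and> j \<le> card (across \<Q>) + 1" if "j \<le> card \<P>" for j
    using that
  proof (induction j)
    case 0
    show ?case by (intro exI[of _ "{}"]) simp
  next
    case (Suc j)
    then obtain \<Q> where Q: "\<Q> \<subseteq> \<P>" "card \<Q> = j" "j \<le> card (across \<Q>) + 1" by auto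
    have finQ: "finite \<Q>" using Q(1) finP finite_subset by blast
    obtain B0 where B0: "B0 \<in> \<P>" "B0 \<notin> \<Q>"
      using Q(1,2) Suc.prems by (metis Suc_n_not_le_n subsetI subset_antisym)
    show ?case
    \<comment> \<open>The first block is taken without an edge, since none leaves an empty union;
      this accounts for the \<open>+ 1\<close>.\<close>
    proof (cases "j = 0")
      case True
      then have "card {B0} = Suc j \<and> Suc j \<le> card (across {B0}) + 1" by simp
      then show ?thesis using B0(1) by blast
    next
      case False
      then obtain B1 where B1: "B1 \<in> \<Q>" using Q(2) by fastforce
      have "\<Union>\<Q> \<noteq> {}" using B1 Q(1) part(2) by (metis Sup_upper subsetD subset_empty)
      moreover have "\<Union>\<Q> \<noteq> V"
      proof
        assume eq: "\<Union>\<Q> = V"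
        obtain x where x: "x \<in> B0" using B0(1) part(2) by fastforce
        then obtain B where B: "B \<in> \<Q>" "x \<in> B" using eq part(1) B0(1) by blast
        then have "disjnt B B0" using B0 Q(1) part(3) by (metis pairwiseD subsetD)
        then show False using x B(2) by (auto simp: disjnt_def)
      qed
      moreover have "\<Union>\<Q> \<subseteq> V" using Q(1) part(1) by blast
      ultimately obtain x y where xy: "{x, y} \<in> E" "x \<in> \<Union>\<Q>" "y \<in> V - \<Union>\<Q>"
        using connected_crossing_edge[OF conn sub, of "\<Union>\<Q>"] by blast
      then obtain B where B: "B \<in> \<P>" "y \<in> B" using part(1) by blast
      have BQ: "B \<notin> \<Q>" using B xy(3) by blast
      obtain A where A: "A \<in> \<Q>" "x \<in> A" using xy(2) by blast
      have "\<not> {x, y} \<subseteq> D" if D: "D \<in> \<P>" for D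
      proof
        assume "{x, y} \<subseteq> D"
        then have "\<not> disjnt A D" "D \<noteq> A" using A xy(3) by (auto simp: disjnt_def)
        then show False using D A(1) Q(1) part(3) by (metis pairwiseD subsetD)
      qed
      then have "insert {x, y} (across \<Q>) \<subseteq> across (insert B \<Q>)"
        using xy B by (auto simp: across_def)
      then have "card (insert {x, y} (across \<Q>)) \<le> card (across (insert B \<Q>))"
        by (intro card_mono fin_across)
      moreover have "{x, y} \<notin> across \<Q>" using xy(3) by (auto simp: across_def)
      ultimately have "Suc (card (across \<Q>)) \<le> card (across (insert B \<Q>))"
        using fin_across by simp
      then show ?thesis using Q B(1) BQ finQ by (intro exI[of _ "insert B \<Q>"]) auto
    qed
  qed
  from this[of "card \<P>"] obtain \<Q> where "\<Q> \<subseteq> \<P>" "card \<P> \<le> card (across \<Q>) + 1" by auto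
  moreover have "card (across \<Q>) \<le> card {e\<in>E. \<forall>B\<in>\<P>. \<not> e \<subseteq> B}"
    using finE by (intro card_mono) (auto simp: across_def)
  ultimately show ?thesis by linarith
qed

lemma sum_degree_eq:
  assumes "finite E" and "finite X"
  shows "(\<Sum>v\<in>X. degree E v) = (\<Sum>e\<in>E. card (e \<inter> X))"
proof -
  have "(\<Sum>v\<in>X. degree E v) = (\<Sum>v\<in>X. \<Sum>e\<in>E. if v \<in> e then 1 else 0)"
    using assms(1) by (simp add: degree_def sum.If_cases Int_def)
  also have "\<dots> = (\<Sum>e\<in>E. \<Sum>v\<in>X. if v \<in> e then 1 else 0)" by (rule sum.swap)
  also have "\<dots> = (\<Sum>e\<in>E. card (e \<inter> X))"
    using assms(2) by (simp add: sum.If_cases Int_def conj_commute)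
  finally show ?thesis .
qed

text \<open>The degree sum over \<open>X\<close> counts an edge inside \<open>X\<close> twice and an
  edge leaving \<open>X\<close> once.\<close>

lemma two_edges_within_le:
  assumes fin: "finite E" "finite X" and two: "\<forall>e\<in>E. card e = 2" and deg: "\<forall>v\<in>X. degree E v \<le> k"
  shows "2 * card {e\<in>E. e \<subseteq> X} + card {e\<in>E. e \<inter> X \<noteq> {} \<and> \<not> e \<subseteq> X} \<le> k * card X"
proof -
  let ?A = "{e\<in>E. e \<subseteq> X}" and ?B = "{e\<in>E. e \<inter> X \<noteq> {} \<and> \<not> e \<subseteq> X}"
  have "2 * card ?A = (\<Sum>e\<in>?A. card (e \<inter> X))" using two by (simp add: Int_absorb2)
  moreover have "card (e \<inter> X) \<ge> 1" if "e \<in> ?B" for e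
    using that fin(2) by (simp add: Suc_le_eq card_gt_0_iff)
  then have "(\<Sum>e\<in>?B. 1) \<le> (\<Sum>e\<in>?B. card (e \<inter> X))" by (rule sum_mono)
  then have "card ?B \<le> (\<Sum>e\<in>?B. card (e \<inter> X))" by simp
  ultimately have "2 * card ?A + card ?B \<le> (\<Sum>e\<in>?A \<union> ?B. card (e \<inter> X))"
    using fin(1) by (subst sum.union_disjoint) auto
  also have "\<dots> \<le> (\<Sum>e\<in>E. card (e \<inter> X))" using fin(1) by (intro sum_mono2) auto
  also have "\<dots> = (\<Sum>v\<in>X. degree E v)" using sum_degree_eq[OF fin] by simp
  also have "\<dots> \<le> k * card X" using sum_bounded_above[of X "degree E" k] deg by (simp add: mult.commute)
  finally show ?thesis .
qed

lemma card_edges_meeting_le: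
  assumes "finite S" and "\<forall>v\<in>S. degree E v \<le> k"
  shows "card {e\<in>E. e \<inter> S \<noteq> {}} \<le> k * card S"
proof -
  have "{e\<in>E. e \<inter> S \<noteq> {}} = (\<Union>v\<in>S. {e\<in>E. v \<in> e})" by auto
  then have "card {e\<in>E. e \<inter> S \<noteq> {}} \<le> (\<Sum>v\<in>S. degree E v)"
    using card_UN_le[OF assms(1)] by (simp add: degree_def)
  also have "\<dots> \<le> k * card S"
    using sum_bounded_above[of S "degree E" k] assms(2) by (simp add: mult.commute)
  finally show ?thesis .
qed

lemma two_edges_within_le_complete:
  assumes fin: "finite X" and two: "\<forall>e\<in>E. card e = 2"
  shows "2 * card {e\<in>E. e \<subseteq> X} \<le> card X * (card X - 1)"
proof -
  have "card {e\<in>E. e \<subseteq> X} \<le> card {e. e \<subseteq> X \<and> card e = 2}"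
    using two fin by (intro card_mono) auto
  also have "\<dots> = card X choose 2" using n_subsets[OF fin] by simp
  finally show ?thesis by (simp add: choose_two)
qed

section \<open>Arithmetic for a single vertex set\<close>

text \<open>Below order \<open>k\<close> the complete-graph bound on \<open>m\<close> suffices,
  above it the degree bound, and parity excludes \<open>N = k\<close>. As \<open>k * N\<close> is
  even, the last hypothesis improves to \<open>2 * m + 2 \<le> k * N\<close>; this gain is what
  makes the second case work already from \<open>N = k + 1\<close>.\<close>

lemma odd_set_bound:
  fixes k N m :: nat
  assumes "4 \<le> k" and "even k" and "odd N" and "2 * m \<le> N * (N - 1)" and m: "2 * m + 1 \<le> k * N"
  shows "2 * (int N + int k * int m - 1) \<le> int k * (int k + 1) * (int N - 1)"
proof -
  define K M L where "K = int k" and "M = int N" and "L = int m"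
  have K: "K \<ge> 4" and M: "M \<ge> 1"
    using assms(1) odd_pos[OF assms(3)] by (auto simp: K_def M_def)
  have "even (k * N)" using assms(2) by simp
  then have "2 * m + 2 \<le> k * N" using m by presburger
  then have "int (2 * m + 2) \<le> int (k * N)" by (simp only: of_nat_le_iff)
  then have L1: "2 * L \<le> K * M - 2" by (simp add: K_def M_def L_def)
  have "int (2 * m) \<le> int (N * (N - 1))" using assms(4) by (simp only: of_nat_le_iff)
  then have L2: "2 * L \<le> M * (M - 1)" using M by (simp add: M_def L_def of_nat_diff)
  have "N \<noteq> k" using assms by auto
  then consider "N + 1 \<le> k" | "k + 1 \<le> N" by linarith
  then have "2 * (M + K * L - 1) \<le> K * (K + 1) * (M - 1)"
  proof cases
    case 1
    then have le: "M + 1 \<le> K" by (simp add: K_def M_def)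
    have "K * (2 * L) \<le> K * (M * (M - 1))" using L2 K by (intro mult_left_mono) auto
    moreover have "K * 2 \<le> K * (K + 1 - M)" using le K by (intro mult_left_mono) auto
    then have "0 \<le> K * (K + 1 - M) - 2" using K by linarith
    \<comment> \<open>With \<open>2 * L\<close> replaced by \<open>M * (M - 1)\<close>, this product
      is exactly the right side minus the left.\<close>
    then have "0 \<le> (M - 1) * (K * (K + 1 - M) - 2)" using M by (intro mult_nonneg_nonneg) auto
    ultimately show ?thesis by (simp add: algebra_simps)
  next
    case 2
    then have le: "K + 1 \<le> M" by (simp add: K_def M_def)
    have "K * (2 * L) \<le> K * (K * M - 2)" using L1 K by (intro mult_left_mono) auto
    \<comment> \<open>Again the exact difference of the two sides, now with \<open>2 * L\<close>
      replaced by \<open>K * M - 2\<close>.\<close>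
    moreover have "0 \<le> (K - 2) * (M - (K + 1))" using K le by (intro mult_nonneg_nonneg) auto
    ultimately show ?thesis by (simp add: algebra_simps)
  qed
  then show ?thesis by (simp add: K_def M_def L_def)
qed

text \<open>With the degree bound alone the right side exceeds the left by at least
  \<open>(k - 2) * (N - (k + 5)) + 2 * (k - 4)\<close>. The threshold \<open>k + 5\<close> is the
  first odd order beyond the exceptional ones.\<close>

lemma large_order_bound:
  fixes k N m :: nat
  assumes "4 \<le> k" and "k + 5 \<le> N" and "2 * m \<le> k * N"
  shows "2 * (int N + int k * int m - 1) \<le> int k * (int k + 1) * (int N - 1)"
proof -
  define K M L where "K = int k" and "M = int N" and "L = int m"
  have K: "K \<ge> 4" and M: "M \<ge> K + 5" using assms by (auto simp: K_def M_def)
  have "int (2 * m) \<le> int (k * N)" using assms(3) by (simp only: of_nat_le_iff)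
  then have "2 * L \<le> K * M" by (simp add: K_def M_def L_def)
  then have "K * (2 * L) \<le> K * (K * M)" using K by (intro mult_left_mono) auto
  moreover have "0 \<le> (K - 2) * (M - (K + 5))" using K M by (intro mult_nonneg_nonneg) auto
  ultimately have "2 * (M + K * L - 1) \<le> K * (K + 1) * (M - 1)"
    using K by (simp only: algebra_simps)
  then show ?thesis by (simp add: K_def M_def L_def)
qed

text \<open>Serves vertices lying in no odd set, for which the right side keeps the full
  \<open>N\<close>.\<close>

lemma sparse_set_bound:
  fixes k N m :: nat
  assumes "4 \<le> k" and "2 * m \<le> k * N"
  shows "2 * (int N + int k * int m) \<le> int k * (int k + 1) * int N"
proof -
  have "int (2 * m) \<le> int (k * N)" using assms(2) by (simp only: of_nat_le_iff)
  then have "int k * (2 * int m) \<le> int k * (int k * int N)" by (intro mult_left_mono) auto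
  moreover have "2 * int N \<le> int k * int N" using assms(1) by (intro mult_right_mono) auto
  ultimately show ?thesis by (simp add: algebra_simps)
qed

section \<open>From the Tutte-Berge formula to the bound\<close>

text \<open>The odd sets and the remaining vertices \<open>R\<close> obey inequalities of their own.
  What is left concerns the \<open>t\<close> edges meeting \<open>S\<close>, which are bounded from
  both sides.\<close>

lemma barrier_bound:
  assumes conn: "connected_graph V E" and fin: "finite V" and edges: "\<forall>e\<in>E. e \<subseteq> V \<and> card e = 2"
    and deg: "\<forall>v\<in>V. degree E v \<le> k" and k: "4 \<le> k" "even k"
    and S: "S \<subseteq> V" "S \<noteq> {}" and disj: "pairwise disjnt \<C>"
    and odd: "\<forall>C\<in>\<C>. C \<subseteq> V - S \<and> odd (card C)"
    and closed: "\<forall>C\<in>\<C>. \<forall>e\<in>E. e \<inter> C \<noteq> {} \<longrightarrow> e \<subseteq> C \<union> S"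
  shows "2 * (int (card V) + int k * int (card E) - 1)
           \<le> int k * (int k + 1) * (int (card V) + int (card S) - int (card \<C>))"
proof -
  have two: "\<forall>e\<in>E. card e = 2" and sub: "\<forall>e\<in>E. e \<subseteq> V" using edges by auto
  have finE: "finite E" using fin sub by (auto intro: finite_subset[of _ "Pow V"])
  have finS: "finite S" using S(1) fin finite_subset by blast
  have CV: "\<Union>\<C> \<subseteq> V" using odd by blast
  then have finUC: "finite (\<Union>\<C>)" using fin finite_subset by blast
  then have finC: "finite \<C>" by (rule finite_UnionD)
  have finC1: "finite C" if "C \<in> \<C>" for C using that finUC by (meson Union_upper finite_subset)
  define R where "R = V - S - \<Union>\<C>"
  have finR: "finite R" using fin by (simp add: R_def)
  define t where "t = card {e\<in>E. e \<inter> S \<noteq> {}}"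
  define c where "c C = card {e\<in>E. e \<subseteq> C}" for C
  have "card (S \<union> \<Union>\<C>) = card S + card (\<Union>\<C>)"
    using odd by (intro card_Un_disjoint finS finUC) blast
  moreover have "V = R \<union> (S \<union> \<Union>\<C>)" using S(1) CV by (auto simp: R_def)
  moreover have "card (R \<union> (S \<union> \<Union>\<C>)) = card R + card (S \<union> \<Union>\<C>)"
    using finR finS finUC by (intro card_Un_disjoint) (auto simp: R_def)
  moreover have "card (\<Union>\<C>) = (\<Sum>C\<in>\<C>. card C)"
    using disj finC1 by (intro card_Union_disjoint)
  ultimately have cardV: "card V = card S + card R + (\<Sum>C\<in>\<C>. card C)" by simp

  have within: "e \<in> {e\<in>E. e \<inter> S \<noteq> {}} \<union> (\<Union>C\<in>\<C>. {e\<in>E. e \<subseteq> C}) \<union> {e\<in>E. e \<subseteq> R}" if e: "e \<in> E" for e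
  proof (cases "e \<inter> S = {} \<and> (\<forall>C\<in>\<C>. e \<inter> C = {})")
    case True
    then have "e \<subseteq> R" using e sub unfolding R_def by blast
    then show ?thesis using e by blast
  next
    case False
    then show ?thesis using closed e by blast
  qed
  have "card E \<le> card ({e\<in>E. e \<inter> S \<noteq> {}} \<union> (\<Union>C\<in>\<C>. {e\<in>E. e \<subseteq> C}) \<union> {e\<in>E. e \<subseteq> R})"
    using finE finC within by (intro card_mono) auto
  also have "\<dots> \<le> card ({e\<in>E. e \<inter> S \<noteq> {}} \<union> (\<Union>C\<in>\<C>. {e\<in>E. e \<subseteq> C})) + c R"
    unfolding c_def by (rule card_Un_le)
  also have "\<dots> \<le> t + card (\<Union>C\<in>\<C>. {e\<in>E. e \<subseteq> C}) + c R"
    unfolding t_def by (intro add_right_mono card_Un_le)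
  also have "\<dots> \<le> t + (\<Sum>C\<in>\<C>. c C) + c R"
    unfolding c_def using card_UN_le[OF finC] by (intro add_right_mono add_left_mono)
  finally have cardE: "card E \<le> t + (\<Sum>C\<in>\<C>. c C) + c R" .

  have boundR: "2 * (int (card R) + int k * int (c R)) \<le> int k * (int k + 1) * int (card R)"
  proof (rule sparse_set_bound[OF k(1)])
    have "\<forall>v\<in>R. degree E v \<le> k" using deg by (auto simp: R_def)
    then show "2 * c R \<le> k * card R"
      using two_edges_within_le[OF finE finR two] unfolding c_def by (meson add_leD1)
  qed

  have boundC: "2 * (int (card C) + int k * int (c C)) \<le> int k * (int k + 1) * (int (card C) - 1) + 2"
    if C: "C \<in> \<C>" for C
  proof -
    \<comment> \<open>Since \<open>S\<close> is non-empty, \<open>C\<close> is not all of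
      \<open>V\<close>, so connectivity yields an edge leaving \<open>C\<close>; it supplies the
      \<open>+ 1\<close> required by \<open>odd_set_bound\<close>.\<close>
    have "C \<subseteq> V" "C \<noteq> {}" "C \<noteq> V" using C odd S by auto
    then obtain x y where xy: "{x, y} \<in> E" "x \<in> C" "y \<in> V - C"
      using connected_crossing_edge[OF conn sub] by blast
    then have "{x, y} \<in> {e\<in>E. e \<inter> C \<noteq> {} \<and> \<not> e \<subseteq> C}" by auto
    then have "card {e\<in>E. e \<inter> C \<noteq> {} \<and> \<not> e \<subseteq> C} \<ge> 1"
      using finE by (simp add: Suc_le_eq card_gt_0_iff) blast
    moreover have "\<forall>v\<in>C. degree E v \<le> k" using deg \<open>C \<subseteq> V\<close> by blast
    ultimately have "2 * c C + 1 \<le> k * card C"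
      using two_edges_within_le[OF finE finC1[OF C] two] unfolding c_def by fastforce
    moreover have "2 * c C \<le> card C * (card C - 1)"
      using two_edges_within_le_complete[OF finC1[OF C] two] by (simp add: c_def)
    ultimately show ?thesis using odd_set_bound[OF k, of "card C" "c C"] odd C by simp
  qed
  have "(\<Sum>C\<in>\<C>. 2 * (int (card C) + int k * int (c C)))
      \<le> (\<Sum>C\<in>\<C>. int k * (int k + 1) * (int (card C) - 1) + 2)"
    by (intro sum_mono boundC)
  then have sumC: "2 * ((\<Sum>C\<in>\<C>. int (card C)) + int k * (\<Sum>C\<in>\<C>. int (c C)))
      \<le> int k * (int k + 1) * ((\<Sum>C\<in>\<C>. int (card C)) - int (card \<C>)) + 2 * int (card \<C>)"
    by (simp add: sum.distrib sum_distrib_left[symmetric] sum_subtractf)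

  \<comment> \<open>\<open>R\<close> is dropped when empty because blocks must be non-empty. By
    \<open>within\<close>, an edge contained in no block meets \<open>S\<close>, so at most
    \<open>t\<close> edges run between blocks.\<close>
  define \<P> where "\<P> = (\<lambda>s. {s}) ` S \<union> \<C> \<union> (if R = {} then {} else {R})"
  have "card \<P> \<le> card {e\<in>E. \<forall>B\<in>\<P>. \<not> e \<subseteq> B} + 1"
  proof (rule connected_partition_edges[OF conn fin sub])
    show "\<Union>\<P> = V" unfolding \<P>_def R_def using S(1) CV by auto
    show "{} \<notin> \<P>" unfolding \<P>_def using odd by auto
    have "disjnt C R" if "C \<in> \<C>" for C using that by (auto simp: R_def disjnt_def)
    moreover have "disjnt {s} R" if "s \<in> S" for s using that by (auto simp: R_def disjnt_def)
    moreover have "disjnt {s} C" if "s \<in> S" "C \<in> \<C>" for s C using that odd by (auto simp: disjnt_def)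
    ultimately show "pairwise disjnt \<P>"
      using disj unfolding \<P>_def pairwise_def by (auto simp: disjnt_sym)
  qed
  moreover have "card {e\<in>E. \<forall>B\<in>\<P>. \<not> e \<subseteq> B} \<le> t"
    unfolding t_def
  proof (intro card_mono subsetI)
    fix e assume e: "e \<in> {e\<in>E. \<forall>B\<in>\<P>. \<not> e \<subseteq> B}"
    moreover have "e \<noteq> {}" using e two by auto
    ultimately have "\<forall>C\<in>\<C>. \<not> e \<subseteq> C" "\<not> e \<subseteq> R" by (auto simp: \<P>_def split: if_splits)
    then show "e \<in> {e\<in>E. e \<inter> S \<noteq> {}}" using e within[of e] by simp
  qed (use finE in simp)
  moreover have "card S + card \<C> \<le> card \<P>"
  proof -
    have "(\<lambda>s. {s}) ` S \<inter> \<C> = {}" using odd by auto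
    then have "card ((\<lambda>s. {s}) ` S \<union> \<C>) = card S + card \<C>"
      using finS finC by (simp add: card_Un_disjoint card_image)
    then show ?thesis using card_mono[of \<P> "(\<lambda>s. {s}) ` S \<union> \<C>"] finS finC
      by (auto simp: \<P>_def)
  qed
  ultimately have lower: "int (card S) + int (card \<C>) \<le> int t + 1" by linarith
  have "\<forall>v\<in>S. degree E v \<le> k" using deg S(1) by blast
  then have "t \<le> k * card S" unfolding t_def by (rule card_edges_meeting_le[OF finS])
  then have upper: "int t \<le> int k * int (card S)" by (metis of_nat_le_iff of_nat_mult)
  \<comment> \<open>Writing s for \<open>card S\<close> and q for \<open>card \<C>\<close>, the
    claim reduces to 2(s + q - 1) + 2kt \<le> 2k(k + 1)s. By \<open>lower\<close> the left side is
    at most 2(k + 1)t, and \<open>upper\<close> finishes.\<close>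
  have "2 * (int k + 1) * int t \<le> 2 * (int k + 1) * (int k * int (card S))"
    using upper by (intro mult_left_mono) auto
  moreover have "int k * int (card E) \<le> int k * (int t + (\<Sum>C\<in>\<C>. int (c C)) + int (c R))"
    using cardE by (intro mult_left_mono) (auto simp flip: of_nat_sum of_nat_add)
  ultimately show ?thesis
    using lower boundR sumC unfolding cardV by (simp add: algebra_simps)
qed

text \<open>The first alternative is the desired bound cleared of denominators. The second is needed
  only when \<open>S\<close> is empty and \<open>V\<close> itself is the one odd set.\<close>

lemma matching_number_dichotomy:
  assumes conn: "connected_graph V E" and fin: "finite V"
    and edges: "\<forall>e\<in>E. e \<subseteq> V \<and> card e = 2"
    and deg: "\<forall>v\<in>V. degree E v \<le> k" and k: "4 \<le> k" "even k"
  shows "2 * (int (card V) + int k * int (card E) - 1) \<le> int k * (int k + 1) * (2 * int (matching_number E))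
       \<or> (odd (card V) \<and> card V \<le> 2 * matching_number E + 1)"
proof -
  obtain S \<C> where S: "S \<subseteq> V" and disj: "pairwise disjnt \<C>"
    and odd: "\<forall>C\<in>\<C>. C \<subseteq> V - S \<and> odd (card C)"
    and closed: "\<forall>C\<in>\<C>. \<forall>e\<in>E. e \<inter> C \<noteq> {} \<longrightarrow> e \<subseteq> C \<union> S"
    and card: "card V + card S \<le> 2 * matching_number E + card \<C>"
    using Tutte_Berge[OF fin edges] by (elim exE conjE) (rule that)
  have two: "\<forall>e\<in>E. card e = 2" and sub: "\<forall>e\<in>E. e \<subseteq> V" using edges by auto
  have finE: "finite E" using fin sub by (auto intro: finite_subset[of _ "Pow V"])
  show ?thesis
  proof (cases "S = {}")
    case False
    have "2 * (int (card V) + int k * int (card E) - 1)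
        \<le> int k * (int k + 1) * (int (card V) + int (card S) - int (card \<C>))"
      using barrier_bound[OF conn fin edges deg k S False disj odd closed] .
    also have "\<dots> \<le> int k * (int k + 1) * (2 * int (matching_number E))"
      using card by (intro mult_left_mono) auto
    finally show ?thesis ..
  next
    case True
    \<comment> \<open>With \<open>S\<close> empty no edge leaves an odd set, so connectivity makes
      it the whole of \<open>V\<close>.\<close>
    have CV: "C = V" if C: "C \<in> \<C>" for C
    proof (rule ccontr)
      assume "C \<noteq> V"
      moreover have "C \<subseteq> V" "C \<noteq> {}" using C odd by auto
      ultimately obtain x y where xy: "{x, y} \<in> E" "x \<in> C" "y \<in> V - C"
        using connected_crossing_edge[OF conn sub] by blast
      then show False using closed[rule_format, OF C xy(1)] True by auto
    qed
    show ?thesis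
    proof (cases "\<C> = {}")
      case False
      then have "\<C> = {V}" using CV by blast
      then show ?thesis using card odd True by simp
    next
      case empty: True
      have "{e \<in> E. e \<subseteq> V} = E" using sub by blast
      then have "2 * card E \<le> k * card V"
        using two_edges_within_le[OF finE fin two deg] by simp
      from sparse_set_bound[OF k(1) this]
      have "2 * (int (card V) + int k * int (card E) - 1) \<le> int k * (int k + 1) * int (card V)" by simp
      also have "\<dots> \<le> int k * (int k + 1) * (2 * int (matching_number E))"
        using card empty by (intro mult_left_mono) auto
      finally show ?thesis ..
    qed
  qed
qed

section \<open>The theorem and its two exceptional cases\<close>

theorem corollary1:
  fixes V :: "'a set" and E :: "'a set set" and k n m :: nat
  assumes "4 \<le> k" and "even k"
    and "simple_graph V E" and "connected_graph V E"
    and "n = card V" and "m = card E"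
    and "max_degree V E \<le> k"
  shows "(\<not> (regular k V E \<and> n = k + 1) \<and> \<not> (regular k V E \<and> n = k + 3) \<longrightarrow>
            real (matching_number E) \<ge>
              real n / (real k * (real k + 1)) + real m / (real k + 1) - 1 / (real k * (real k + 1)))
       \<and> (regular k V E \<and> n = k + 1 \<longrightarrow>
            real (matching_number E) = (real n - 1) / 2 \<and>
            (real n - 1) / 2 =
              real n / (real k * (real k + 1)) + real m / (real k + 1) - 1 / real k)
       \<and> (regular k V E \<and> n = k + 3 \<longrightarrow>
            real (matching_number E) = (real n - 1) / 2 \<and>
            (real n - 1) / 2 =
              real n / (real k * (real k + 1)) + real m / (real k + 1) - 3 / (real k * (real k + 1)))"
proof -
  note k = assms(1,2) and n = assms(5) and m = assms(6)
  interpret simple_graph V E by fact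
  have edges: "\<forall>e\<in>E. e \<subseteq> V \<and> card e = 2" using edge_subset edge_card by blast
  then have two: "\<forall>e\<in>E. card e = 2" by blast
  have finE: "finite E" using finite_V edges by (auto intro: finite_subset[of _ "Pow V"])
  have deg: "degree E v \<le> k" if "v \<in> V" for v
    using assms(7) that finite_V unfolding max_degree_def
    by (meson Max_ge finite_imageI imageI le_trans)
  have within: "{e \<in> E. e \<subseteq> V} = E" using edges by blast
  have "e \<inter> V = e" if "e \<in> E" for e using edges that by blast
  then have handshake: "(\<Sum>v\<in>V. degree E v) = 2 * m"
    using sum_degree_eq[OF finE finite_V] two m by simp
  have upper: "2 * matching_number E \<le> n"
  proof -
    obtain M where M: "maximum_matching E M" using maximum_matching_exists[OF finE] .
    then have mM: "matching E M" by (simp add: maximum_matching_def)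
    have "\<Union>M \<subseteq> V" using mM edges by (auto simp: matching_def)
    then have "card (\<Union>M) \<le> n" using n finite_V by (simp add: card_mono)
    then show ?thesis using two_card_matching[OF finE two mM] M by (simp add: maximum_matching_def)
  qed
  have deg_bound: "2 * m \<le> k * n"
    using two_edges_within_le[OF finE finite_V two, of k] deg within n m by auto
  define bound where "bound \<longleftrightarrow>
    2 * (int n + int k * int m - 1) \<le> int k * (int k + 1) * (2 * int (matching_number E))"
  have dich: "bound \<or> (odd n \<and> n \<le> 2 * matching_number E + 1)"
    unfolding bound_def n m
    using matching_number_dichotomy[OF assms(4) finite_V edges _ k] deg by blast
  have bound_real: "real (matching_number E) \<ge>
      real n / (real k * (real k + 1)) + real m / (real k + 1) - 1 / (real k * (real k + 1))" if bound
  proof -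
    have "real_of_int (2 * (int n + int k * int m - 1))
        \<le> real_of_int (int k * (int k + 1) * (2 * int (matching_number E)))"
      using that unfolding bound_def by (simp only: of_int_le_iff)
    then have "real n + real k * real m - 1 \<le> real k * (real k + 1) * real (matching_number E)"
      by simp
    moreover have "real m / (real k + 1) = real k * real m / (real k * (real k + 1))"
      using k(1) by simp
    then have "real n / (real k * (real k + 1)) + real m / (real k + 1) - 1 / (real k * (real k + 1))
        = (real n + real k * real m - 1) / (real k * (real k + 1))"
      by (simp only: add_divide_distrib diff_divide_distrib)
    ultimately show ?thesis using k(1) by (simp add: divide_le_eq mult.commute)
  qed
  have generic: bound if not_exc: "\<not> (regular k V E \<and> (n = k + 1 \<or> n = k + 3))"
  proof (rule ccontr)
    assume nb: "\<not> bound"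
    then have oddn: "odd n" and le: "n \<le> 2 * matching_number E + 1" using dich by auto
    \<comment> \<open>By \<open>le\<close>, it suffices to prove the bound with \<open>n - 1\<close>
      in place of twice the matching number.\<close>
    have "2 * (int n + int k * int m - 1) \<le> int k * (int k + 1) * (int n - 1)"
    proof (cases "k + 5 \<le> n")
      case True
      then show ?thesis using large_order_bound[OF k(1) _ deg_bound] by blast
    next
      case False
      have complete: "2 * m \<le> n * (n - 1)"
        using two_edges_within_le_complete[OF finite_V two] within n m by simp
      have "2 * m + 1 \<le> k * n"
      proof (cases "regular k V E")
        case True
        \<comment> \<open>Here \<open>n\<close> is odd, at most \<open>k + 4\<close>, and neither
          \<open>k + 1\<close> nor \<open>k + 3\<close>; as \<open>k\<close> is even, only orders
          below \<open>k\<close> remain.\<close>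
        then have "n < k" using False not_exc k oddn by presburger
        then have "n * (n - 1) < n * k" using odd_pos[OF oddn] by (intro mult_strict_left_mono) auto
        then show ?thesis using complete by (simp only: mult.commute[of n k])
      next
        case False
        then obtain w where "w \<in> V" "degree E w < k"
          using deg unfolding regular_def by (meson le_neq_implies_less)
        then have "(\<Sum>v\<in>V. degree E v) < (\<Sum>v\<in>V. k)"
          using deg finite_V by (intro sum_strict_mono_ex1) auto
        then show ?thesis using handshake n by (simp add: mult.commute)
      qed
      then show ?thesis using odd_set_bound[OF k oddn complete] by blast
    qed
    also have "\<dots> \<le> int k * (int k + 1) * (2 * int (matching_number E))"
      using le by (intro mult_left_mono) auto
    finally show False using nb by (simp add: bound_def)
  qed
  have exact: "real (matching_number E) = (real n - 1) / 2 \<and> 2 * real m = real k * real n"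
    if reg: "regular k V E" and exc: "n = k + 1 \<or> n = k + 3"
  proof -
    have oddn: "odd n" using exc k(2) by auto
    have m_eq: "2 * m = k * n" using handshake reg n by (simp add: regular_def mult.commute)
    \<comment> \<open>Refuting \<open>bound\<close> leaves the other alternative of
      \<open>dich\<close>, which together with \<open>upper\<close> and parity determines the
      matching number.\<close>
    have not_bound: "\<not> bound"
    proof
      assume bound
      have "2 * matching_number E \<le> n - 1" using upper oddn by presburger
      then have "2 * int (matching_number E) \<le> int n - 1" using odd_pos[OF oddn] by linarith
      then have "int k * (int k + 1) * (2 * int (matching_number E)) \<le> int k * (int k + 1) * (int n - 1)"
        by (intro mult_left_mono) auto
      then have "2 * (int n + int k * int m - 1) \<le> int k * (int k + 1) * (int n - 1)"
        using \<open>bound\<close> unfolding bound_def by linarith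
      moreover have "2 * int m = int k * int n" using m_eq by (metis of_nat_mult of_nat_numeral)
      then have "int k * (2 * int m) = int k * (int k * int n)" by simp
      ultimately have "2 * int n - 2 + int k * (int k * int n) \<le> int k * (int k + 1) * (int n - 1)"
        by (simp only: algebra_simps)
      \<comment> \<open>The left side is larger by \<open>2 * k\<close> when
        \<open>n = k + 1\<close> and by 4 when \<open>n = k + 3\<close>.\<close>
      then show False using exc k(1) by (auto simp: algebra_simps)
    qed
    then have "n \<le> 2 * matching_number E + 1" using dich by blast
    then have "n = 2 * matching_number E + 1" using upper oddn by presburger
    moreover have "2 * real m = real k * real n" using m_eq by (metis of_nat_mult of_nat_numeral)
    ultimately show ?thesis by simp
  qed
  \<comment> \<open>The numerators are left unsimplified so that the identities match the goals once
    \<open>n\<close> and \<open>m\<close> have been replaced by their values in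
    \<open>k\<close>.\<close>
  have order1: "(x + 1 - 1) / 2 = (x + 1) / (x * (x + 1)) + x * (x + 1) / 2 / (x + 1) - 1 / x"
    if "x > 0" for x :: real
    using that by (simp add: divide_simps)
  have order3: "(x + 3 - 1) / 2 =
      (x + 3) / (x * (x + 1)) + x * (x + 3) / 2 / (x + 1) - 3 / (x * (x + 1))"
    if "x > 0" for x :: real
    using that by (simp add: divide_simps) algebra
  have "(real n - 1) / 2 = real n / (real k * (real k + 1)) + real m / (real k + 1) - 1 / real k"
    if "regular k V E" "n = k + 1"
  proof -
    have n1: "real n = real k + 1" using that(2) by simp
    have "2 * real m = real k * real n" using exact that by blast
    then have m1: "real m = real k * (real k + 1) / 2" unfolding n1 by simp
    show ?thesis unfolding n1 m1 using k(1) by (intro order1) simp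
  qed
  moreover have "(real n - 1) / 2 =
      real n / (real k * (real k + 1)) + real m / (real k + 1) - 3 / (real k * (real k + 1))"
    if "regular k V E" "n = k + 3"
  proof -
    have n3: "real n = real k + 3" using that(2) by simp
    have "2 * real m = real k * real n" using exact that by blast
    then have m3: "real m = real k * (real k + 3) / 2" unfolding n3 by simp
    show ?thesis unfolding n3 m3 using k(1) by (intro order3) simp
  qed
  ultimately show ?thesis using generic bound_real exact by blast
qed

end
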